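(* Let $\mathcal{H}$ be a complex Hilbert space and let $\mathcal{L}:\mathcal{D}(\mathcal{L})\rightarrow\mathcal{H}$ be a closed and densely defined linear operator on $\mathcal{H}$. For a fixed $\epsilon>0$, suppose that the linear map $Q:\mathbb{C}^m\rightarrow\mathcal{H}$ satisfies $Q^*Q=I$ and that ${\rm range}(Q)$ is an invariant subspace of $\mathcal{L}$. Then $\lambda_\epsilon(Q^*\mathcal{L}Q)\subset\lambda_\epsilon(\mathcal{L})$.
   Context: That ${\rm range}(Q)$ is an invariant subspace of $\mathcal{L}$ means ${\rm range}(Q)\subset\mathcal{D}(\mathcal{L})$ and $\mathcal{L}({\rm range}(Q))\subset{\rm range}(Q)$. $Q^*:\mathcal{H}\to\mathbb{C}^m$ is the adjoint of $Q$ ($\mathbb{C}^m$ with the standard inner product), so $Q^*\mathcal{L}Q$ is an $m\times m$ matrix, regarded as an operator on the Hilbert space $\mathbb{C}^m$. For $\epsilon>0$ and a closed, densely defined operator $A$ on a Hilbert space $H$ with spectrum $\lambda(A)$, the $\epsilon$-pseudospectrum is $$\lambda_\epsilon(A)=\{z\in\mathbb{C}:\lVert(z\mathcal{I}-A)^{-1}\rVert_H>1/\epsilon\},$$ where $\lVert\cdot\rVert_H$ is the operator norm and, by convention, $\lVert(z\mathcal{I}-A)^{-1}\rVert_H=\infty$ when $z\in\lambda(A)$ (so $\lambda(A)\subset\lambda_\epsilon(A)$). *)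

theory Defs
  imports "HOL-Analysis.Analysis"
begin

class scaleC =
  fixes scaleC :: "complex \<Rightarrow> 'a \<Rightarrow> 'a"  (infixr "*\<^sub>C" 75)

class complex_vector = real_vector + scaleC +
  assumes scaleC_add_right: "c *\<^sub>C (x + y) = c *\<^sub>C x + c *\<^sub>C y"
    and scaleC_add_left: "(c + d) *\<^sub>C x = c *\<^sub>C x + d *\<^sub>C x"
    and scaleC_scaleC: "c *\<^sub>C d *\<^sub>C x = (c * d) *\<^sub>C x"
    and scaleC_one: "1 *\<^sub>C x = x"
    and scaleR_scaleC: "r *\<^sub>R x = complex_of_real r *\<^sub>C x"

global_interpretation complex_vector: vector_space "scaleC :: complex \<Rightarrow> 'a \<Rightarrow> 'a::complex_vector"
  by unfold_locales (rule scaleC_add_right scaleC_add_left scaleC_scaleC scaleC_one)+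

text \<open>
  A complex inner product space, with inner product linear in the first argument. Its norm and
  topology are those of the underlying real inner product space, whose inner product is the real
  part of the complex one: \<open>cinner x x\<close> is real by \<open>cinner_commute\<close>, hence equal to
  \<open>inner x x\<close>, so positive definiteness and \<open>norm x = sqrt (cinner x x)\<close> are
  inherited from the class \<open>real_inner\<close>.
\<close>

class complex_inner = complex_vector + real_inner +
  fixes cinner :: "'a \<Rightarrow> 'a \<Rightarrow> complex"
  assumes cinner_commute: "cinner x y = cnj (cinner y x)"
    and cinner_add_left: "cinner (x + y) z = cinner x z + cinner y z"
    and cinner_scaleC_left: "cinner (c *\<^sub>C x) y = c * cinner x y"
    and inner_eq_Re_cinner: "inner x y = Re (cinner x y)"

class chilbert_space = complex_inner + banach

instantiation complex :: chilbert_space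
begin

definition scaleC_complex :: "complex \<Rightarrow> complex \<Rightarrow> complex"
  where "scaleC_complex c x = c * x"

definition cinner_complex :: "complex \<Rightarrow> complex \<Rightarrow> complex"
  where "cinner_complex x y = x * cnj y"

instance
  by standard (simp_all add: scaleC_complex_def cinner_complex_def inner_complex_def
      scaleR_conv_of_real algebra_simps)

end

instantiation vec :: (complex_vector, finite) complex_vector
begin

definition scaleC_vec :: "complex \<Rightarrow> 'a ^ 'b \<Rightarrow> 'a ^ 'b"
  where "scaleC_vec c x = (\<chi> i. c *\<^sub>C (x $ i))"

instance
  by standard (simp_all add: scaleC_vec_def vec_eq_iff scaleC_add_right scaleC_add_left
      scaleC_scaleC scaleC_one scaleR_scaleC)

end

instantiation vec :: (complex_inner, finite) complex_inner
begin

definition cinner_vec :: "'a ^ 'b \<Rightarrow> 'a ^ 'b \<Rightarrow> complex"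
  where "cinner_vec x y = (\<Sum>i\<in>UNIV. cinner (x $ i) (y $ i))"

instance
proof
  fix x y z :: "'a ^ 'b" and c :: complex
  show "cinner x y = cnj (cinner y x)"
    unfolding cinner_vec_def cnj_sum by (intro sum.cong refl cinner_commute)
  show "cinner (x + y) z = cinner x z + cinner y z"
    by (simp add: cinner_vec_def cinner_add_left sum.distrib)
  show "cinner (c *\<^sub>C x) y = c * cinner x y"
    by (simp add: cinner_vec_def scaleC_vec_def cinner_scaleC_left sum_distrib_left)
  show "inner x y = Re (cinner x y)"
    by (simp add: inner_vec_def cinner_vec_def inner_eq_Re_cinner)
qed

end

instance vec :: (chilbert_space, finite) chilbert_space ..

definition cadjoint :: "('a::complex_inner \<Rightarrow> 'b::complex_inner) \<Rightarrow> 'b \<Rightarrow> 'a"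
  where "cadjoint f = (SOME g. \<forall>x y. cinner (f x) y = cinner x (g y))"

text \<open>
  A possibly unbounded operator is given by its domain \<open>D\<close> and a function \<open>A\<close>, of
  which only the values on \<open>D\<close> are meaningful. Everywhere defined operators, such as
  matrices, have domain \<open>UNIV\<close>.
\<close>

definition linear_operator :: "'a::complex_vector set \<Rightarrow> ('a \<Rightarrow> 'a) \<Rightarrow> bool"
  where "linear_operator D A \<longleftrightarrow>
    complex_vector.subspace D \<and>
    (\<forall>x\<in>D. \<forall>y\<in>D. A (x + y) = A x + A y) \<and>
    (\<forall>c. \<forall>x\<in>D. A (c *\<^sub>C x) = c *\<^sub>C A x)"

definition closed_operator :: "'a::chilbert_space set \<Rightarrow> ('a \<Rightarrow> 'a) \<Rightarrow> bool"
  where "closed_operator D A \<longleftrightarrow> closed {(x, A x) | x. x \<in> D}"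

definition densely_defined :: "'a::chilbert_space set \<Rightarrow> bool"
  where "densely_defined D \<longleftrightarrow> closure D = UNIV"

definition invariant_subspace ::
    "'a::complex_vector set \<Rightarrow> ('a \<Rightarrow> 'a) \<Rightarrow> 'a set \<Rightarrow> bool"
  where "invariant_subspace D A V \<longleftrightarrow>
    complex_vector.subspace V \<and> V \<subseteq> D \<and> A ` V \<subseteq> V"

definition resolvent :: "'a::chilbert_space set \<Rightarrow> ('a \<Rightarrow> 'a) \<Rightarrow> complex \<Rightarrow> 'a \<Rightarrow> 'a"
  where "resolvent D A z = inv_into D (\<lambda>x. z *\<^sub>C x - A x)"

text \<open>
  \<open>bounded_linear\<close> only refers to real scalars, but the inverse of a complex linear
  bijection is automatically complex linear.
\<close>

definition resolvent_set :: "'a::chilbert_space set \<Rightarrow> ('a \<Rightarrow> 'a) \<Rightarrow> complex set"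
  where "resolvent_set D A =
    {z. bij_betw (\<lambda>x. z *\<^sub>C x - A x) D UNIV \<and> bounded_linear (resolvent D A z)}"

definition spectrum :: "'a::chilbert_space set \<Rightarrow> ('a \<Rightarrow> 'a) \<Rightarrow> complex set"
  where "spectrum D A = - resolvent_set D A"

definition resolvent_norm :: "'a::chilbert_space set \<Rightarrow> ('a \<Rightarrow> 'a) \<Rightarrow> complex \<Rightarrow> ereal"
  where "resolvent_norm D A z =
    (if z \<in> spectrum D A then \<infinity> else ereal (onorm (resolvent D A z)))"

definition pseudospectrum ::
    "real \<Rightarrow> 'a::chilbert_space set \<Rightarrow> ('a \<Rightarrow> 'a) \<Rightarrow> complex set"
  where "pseudospectrum \<epsilon> D A = {z. resolvent_norm D A z > ereal (1 / \<epsilon>)}"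

end

theory Submission
  imports Defs
begin

text \<open>
  An isometry \<open>Q\<close> with invariant range intertwines the compression \<open>M = Q\<^sup>* L Q\<close> with
  \<open>L\<close>, that is \<open>Q M = L Q\<close>. Hence wherever \<open>z - L\<close> is invertible, \<open>z - M\<close> is
  injective, so invertible by finite dimension, and \<open>Q (z - M)\<^sup>-\<^sup>1 = (z - L)\<^sup>-\<^sup>1 Q\<close>.
  As \<open>Q\<close> preserves norms, the resolvent of \<open>M\<close> is no larger than that of \<open>L\<close>.
\<close>

lemma cinner_sum_left: "cinner (\<Sum>i\<in>I. f i) y = (\<Sum>i\<in>I. cinner (f i) y)"
  for y :: "'a::complex_inner"
proof -
  interpret additive "\<lambda>x. cinner x y"
    by unfold_locales (rule cinner_add_left)
  show ?thesis by (rule sum)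
qed

lemma vec_eq_sum_axis_scaleC:
  fixes x :: "complex ^ 'm"
  shows "x = (\<Sum>i\<in>UNIV. (x $ i) *\<^sub>C axis i 1)"
  by (simp add: vec_eq_iff sum_component scaleC_vec_def scaleC_complex_def axis_def if_distrib
      sum.delta cong: if_cong)

text \<open>\<open>cadjoint\<close> is a Hilbert choice, so the identity holds once some adjoint
  exists; finite dimension of the domain lets one be written in coordinates.\<close>

lemma cinner_cadjoint:
  fixes f :: "complex ^ 'm \<Rightarrow> 'a::complex_inner"
  assumes "Vector_Spaces.linear scaleC scaleC f"
  shows "cinner (f x) y = cinner x (cadjoint f y)"
proof -
  interpret f: Vector_Spaces.linear scaleC scaleC f by (fact assms)
  \<comment> \<open>Testing the adjoint identity on \<open>axis i 1\<close> forces this i-th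
    coordinate; the conjugate undoes the one \<open>cinner\<close> puts on its second
    argument.\<close>
  have "cinner (f x) y = cinner x (\<chi> i. cnj (cinner (f (axis i 1)) y))" for x y
  proof -
    have "f x = (\<Sum>i\<in>UNIV. (x $ i) *\<^sub>C f (axis i 1))"
      by (subst vec_eq_sum_axis_scaleC) (simp add: f.sum f.scale)
    then show ?thesis
      by (simp add: cinner_sum_left cinner_scaleC_left cinner_vec_def cinner_complex_def)
  qed
  then have "\<exists>g. \<forall>x y. cinner (f x) y = cinner x (g y)"
    by (intro exI[of _ "\<lambda>y. \<chi> i. cnj (cinner (f (axis i 1)) y)"]) blast
  from someI_ex[OF this] show ?thesis
    unfolding cadjoint_def by blast
qed

lemma norm_eq_if_cadjoint_comp_eq_id:
  fixes f :: "complex ^ 'm \<Rightarrow> 'a::complex_inner"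
  assumes "Vector_Spaces.linear scaleC scaleC f" and "cadjoint f \<circ> f = id"
  shows "norm (f x) = norm x"
proof -
  have "cadjoint f (f x) = x"
    using assms(2) by (simp add: fun_eq_iff)
  then have "inner (f x) (f x) = inner x x"
    using cinner_cadjoint[OF assms(1), of x "f x"] by (simp add: inner_eq_Re_cinner)
  then show ?thesis
    by (simp add: norm_eq_sqrt_inner)
qed

lemma resolvent_eqI:
  assumes "inj_on (\<lambda>x. z *\<^sub>C x - A x) D" and "x \<in> D" and "z *\<^sub>C x - A x = y"
  shows "resolvent D A z y = x"
  unfolding resolvent_def by (rule inv_into_f_eq[OF assms])

text \<open>Of the compression, only the intertwining with \<open>L\<close> is kept. The sort
  \<open>euclidean_space\<close> encodes finite dimension.\<close>

lemma resolvent_norm_le_if_intertwining: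
  fixes Q :: "'a::{chilbert_space,euclidean_space} \<Rightarrow> 'h::chilbert_space"
  assumes L: "linear_operator D L"
    and Q: "Vector_Spaces.linear scaleC scaleC Q"
    and isometry: "\<And>x. norm (Q x) = norm x"
    and in_dom: "\<And>x. Q x \<in> D"
    and intertwining: "\<And>x. Q (M x) = L (Q x)"
  shows "resolvent_norm UNIV M z \<le> resolvent_norm D L z"
proof (cases "z \<in> spectrum D L")
  case True
  then show ?thesis by (simp add: resolvent_norm_def)
next
  case False
  define S where "S = (\<lambda>x. z *\<^sub>C x - M x)"
  interpret Q: Vector_Spaces.linear scaleC scaleC Q by (fact Q)
  have inj_L: "inj_on (\<lambda>x. z *\<^sub>C x - L x) D" and bounded_L: "bounded_linear (resolvent D L z)"
    using False by (auto simp: spectrum_def resolvent_set_def bij_betw_def)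
  have inj_Q: "Q x = Q y \<longleftrightarrow> x = y" for x y
    using isometry[of "x - y"] by (auto simp: Q.diff)
  have Q_S: "Q (S x) = z *\<^sub>C Q x - L (Q x)" for x
    by (simp add: S_def Q.diff Q.scale intertwining)
  \<comment> \<open>Linearity of \<open>M\<close> is pulled back from \<open>L\<close>: apply the
    injective \<open>Q\<close> to both sides.\<close>
  have "M (x + y) = M x + M y" for x y
    using L in_dom by (subst inj_Q[symmetric]) (simp add: Q.add intertwining linear_operator_def)
  moreover have "M (c *\<^sub>C x) = c *\<^sub>C M x" for c x
    using L in_dom by (subst inj_Q[symmetric]) (simp add: Q.scale intertwining linear_operator_def)
  ultimately have linear_S: "linear S"
    by (intro linearI) (simp_all add: S_def scaleR_scaleC scaleC_add_right scaleC_scaleC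
        complex_vector.scale_right_diff_distrib mult.commute)
  have inj_S: "inj S"
  proof (rule injI)
    fix x y
    assume "S x = S y"
    then have "z *\<^sub>C Q x - L (Q x) = z *\<^sub>C Q y - L (Q y)"
      by (metis Q_S)
    then show "x = y"
      using inj_onD[OF inj_L] in_dom inj_Q by blast
  qed
  with linear_S have surj_S: "surj S"
    by (rule linear_injective_imp_surjective) (rule refl)
  \<comment> \<open>In finite dimension linearity already gives boundedness, so \<open>z\<close>
    lies in the resolvent set of \<open>M\<close>.\<close>
  have "linear (inv S)"
    using linear_S inj_S by (rule inj_linear_imp_inv_linear)
  then have "z \<in> resolvent_set UNIV M"
    using inj_S surj_S
    by (simp add: resolvent_set_def resolvent_def bij_betw_def linear_conv_bounded_linear S_def)
  moreover have "onorm (inv S) \<le> onorm (resolvent D L z)"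
  proof (rule onorm_le)
    fix y
    \<comment> \<open>\<open>Q (inv S y)\<close> lies in \<open>D\<close> and \<open>z - L\<close>
      sends it to \<open>Q (S (inv S y)) = Q y\<close>; injectivity of \<open>z - L\<close> on
      \<open>D\<close> identifies it.\<close>
    have "Q (inv S y) = resolvent D L z (Q y)"
      using resolvent_eqI[OF inj_L in_dom] Q_S surj_S by (metis surj_f_inv_f)
    then show "norm (inv S y) \<le> onorm (resolvent D L z) * norm y"
      using onorm[OF bounded_L, of "Q y"] isometry by metis
  qed
  ultimately show ?thesis
    using False by (simp add: resolvent_norm_def spectrum_def resolvent_def S_def)
qed

theorem theorem3p2:
  fixes D :: "'h::chilbert_space set"
    and L :: "'h \<Rightarrow> 'h"
    and Q :: "complex ^ 'm \<Rightarrow> 'h"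
    and \<epsilon> :: real
  assumes "linear_operator D L"
    and "closed_operator D L"
    and "densely_defined D"
    and "\<epsilon> > 0"
    and "Vector_Spaces.linear scaleC scaleC Q"
    and "cadjoint Q \<circ> Q = id"
    and "invariant_subspace D L (range Q)"
  shows "pseudospectrum \<epsilon> UNIV (cadjoint Q \<circ> L \<circ> Q) \<subseteq> pseudospectrum \<epsilon> D L"
proof -
  \<comment> \<open>\<open>Q\<close> after \<open>cadjoint Q\<close> fixes every \<open>Q w\<close>,
    and by invariance \<open>L (Q x)\<close> has this form.\<close>
  have "Q ((cadjoint Q \<circ> L \<circ> Q) x) = L (Q x)" for x
  proof -
    obtain w where "L (Q x) = Q w"
      using assms(7) unfolding invariant_subspace_def by blast
    then show ?thesis
      using assms(6) by (simp add: fun_eq_iff)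
  qed
  moreover have "Q x \<in> D" for x
    using assms(7) unfolding invariant_subspace_def by blast
  ultimately have "resolvent_norm UNIV (cadjoint Q \<circ> L \<circ> Q) z \<le> resolvent_norm D L z" for z
    using assms(1,5) norm_eq_if_cadjoint_comp_eq_id[OF assms(5,6)]
    by (intro resolvent_norm_le_if_intertwining)
  then show ?thesis
    unfolding pseudospectrum_def by (auto intro: less_le_trans)
qed

end
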